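(* Let $X$, $Y$ and $Z$ be Banach spaces, and let $U\subseteq X$, $V\subseteq Y$ be open neighborhoods of $0$. Let $\varphi:U\to V$ and $\psi:V\to Z$ be $C^1$-maps. Suppose that (1) $\varphi(0)=0$; (2) $\psi(\varphi(u))=0$ for all $u\in U$; (3) $\operatorname{im}(d\varphi(0))=\ker(d\psi(0))$; (4) $\operatorname{im}(d\psi(0))$ is closed in $Z$. Then there exists a neighborhood $W\subseteq V$ of $0$ in $Y$ such that $$\psi^{-1}(0)\cap W=\varphi(U)\cap W.$$
   Context: A $C^1$-map between open subsets of Banach spaces is a continuously Fréchet differentiable map (the differential is continuous for the operator norm); $d\varphi(x)$ denotes the differential of $\varphi$ at $x$. No subspace is assumed to be complemented. *)

theory Defs
  imports "HOL-Analysis.Analysis"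
begin

(* The derivative takes values in the space of bounded linear operators with the operator norm. *)
definition C1_map_on :: "('a::real_normed_vector \<Rightarrow> 'b::real_normed_vector) \<Rightarrow> 'a set \<Rightarrow> bool"
  where "C1_map_on f U \<longleftrightarrow>
    (\<exists>D :: 'a \<Rightarrow> 'a \<Rightarrow>\<^sub>L 'b.
      (\<forall>x\<in>U. (f has_derivative blinfun_apply (D x)) (at x)) \<and> continuous_on U D)"

end

theory Submission
  imports Defs
begin

text \<open>
  Write \<open>A\<close> and \<open>B\<close> for the differentials of \<open>\<phi>\<close> and \<open>\<psi>\<close> at \<open>0\<close>. The substance is that a small
  \<open>y\<close> with \<open>\<psi> y = 0\<close> has a preimage under \<open>\<phi>\<close>. Since no complements are available, there is no
  implicit function theorem to reduce to; instead the preimage is the limit of a Newton-type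
  iteration in which each correction is merely chosen, with a norm bound.

  Suppose \<open>x\<close> is an approximate preimage with error \<open>e = y - \<phi> x\<close>. Both \<open>y\<close> and \<open>\<phi> x\<close> are zeros
  of \<open>\<psi>\<close>, and \<open>\<psi>\<close> is strictly differentiable at \<open>0\<close> (\<open>C1_map_on_strictly_differentiable\<close>), so
  \<open>norm (B e)\<close> is at most a small multiple of \<open>norm e\<close>. As \<open>B\<close> has closed range, the open mapping
  theorem (\<open>closed_range_bounded_preimage\<close>) turns this into: \<open>e\<close> is close to some \<open>k\<close> in the kernel
  of \<open>B\<close>. By exactness \<open>k = A h\<close>, and the range of \<open>A\<close> is closed because it is a kernel, so \<open>h\<close> can
  be chosen with \<open>norm h\<close> bounded by a multiple of \<open>norm e\<close>. Strict differentiability of \<open>\<phi>\<close> shows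
  that replacing \<open>x\<close> by \<open>x + h\<close> at least halves the error. The corrections therefore form a
  geometrically convergent series, and its sum is the required preimage
  (\<open>solvable_if_error_can_be_halved\<close>). The same summation argument finishes the proof of the open
  mapping theorem once the Baire category theorem has provided approximate preimages.
\<close>

section \<open>Successive approximation\<close>

text \<open>
  Iterating the correction step from \<open>0\<close>, the error after \<open>n\<close> steps is at most
  \<open>norm (y - f 0) / 2 ^ n\<close>; hence the corrections have total length at most
  \<open>2 * K * norm (y - f 0)\<close> and the iterates never leave the ball on which correction is possible.
\<close>
lemma solvable_if_error_can_be_halved:
  fixes f :: "'a::banach \<Rightarrow> 'b::real_normed_vector"
  assumes K: "K \<ge> 0"
    and cont: "continuous_on (cball 0 (2 * K * norm (y - f 0))) f"
    and step: "\<And>x. norm x \<le> 2 * K * norm (y - f 0) \<Longrightarrow> norm (y - f x) \<le> norm (y - f 0) \<Longrightarrow>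
      \<exists>h. norm h \<le> K * norm (y - f x) \<and> norm (y - f (x + h)) \<le> norm (y - f x) / 2"
  shows "\<exists>x. norm x \<le> 2 * K * norm (y - f 0) \<and> f x = y"
proof -
  define N where "N = norm (y - f 0)"
  have N: "N \<ge> 0" by (simp add: N_def)
  define P where "P n x \<longleftrightarrow> norm x \<le> 2 * K * N * (1 - (1/2)^n) \<and> norm (y - f x) \<le> N * (1/2)^n" for n :: nat and x
  have in_ball: "norm x \<le> 2 * K * N" if "P n x" for n x
  proof -
    have "2 * K * N * (1 - (1/2)^n) \<le> 2 * K * N * 1"
      using K N by (intro mult_left_mono) auto
    with that show ?thesis unfolding P_def by linarith
  qed
  have "\<exists>X. \<forall>n. P n (X n) \<and> norm (X (Suc n) - X n) \<le> K * N * (1/2)^n"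
  proof (rule dependent_nat_choice)
    show "\<exists>x. P 0 x" by (rule exI[of _ 0]) (simp add: P_def N_def)
  next
    fix x n assume P: "P n x"
    have "N * (1/2)^n \<le> N * 1"
      using N by (intro mult_left_mono) (auto simp: power_le_one)
    then obtain h where h: "norm h \<le> K * norm (y - f x)" "norm (y - f (x + h)) \<le> norm (y - f x) / 2"
      using step[of x] in_ball[OF P] P unfolding P_def N_def[symmetric] by fastforce
    have "K * norm (y - f x) \<le> K * (N * (1/2)^n)"
      using P K unfolding P_def by (intro mult_left_mono) auto
    then have h': "norm h \<le> K * N * (1/2)^n"
      using h(1) by (simp add: mult.assoc)
    have "norm (x + h) \<le> 2 * K * N * (1 - (1/2)^n) + K * N * (1/2)^n"
      using norm_triangle_ineq[of x h] P h' unfolding P_def by linarith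
    also have "\<dots> = 2 * K * N * (1 - (1/2)^Suc n)"
      by (simp add: algebra_simps)
    finally have "P (Suc n) (x + h)"
      using h(2) P unfolding P_def by simp
    with h' show "\<exists>z. P (Suc n) z \<and> norm (z - x) \<le> K * N * (1/2)^n"
      by (intro exI[of _ "x + h"]) simp
  qed
  then obtain X where P: "\<And>n. P n (X n)" and X: "\<And>n. norm (X (Suc n) - X n) \<le> K * N * (1/2)^n"
    by blast
  have "summable (\<lambda>n. X (Suc n) - X n)"
    by (rule summable_comparison_test'[OF _ X]) (intro summable_mult summable_geometric, simp)
  then have "convergent (\<lambda>n. (\<Sum>i<n. X (Suc i) - X i) + X 0)"
    by (intro convergent_add convergent_const) (simp add: summable_iff_convergent)
  then obtain x where x: "X \<longlonglongrightarrow> x"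
    unfolding sum_lessThan_telescope by (auto simp: convergent_def)
  have nx: "norm x \<le> 2 * K * N"
    by (rule LIMSEQ_le_const2[OF tendsto_norm[OF x]]) (use in_ball[OF P] in auto)
  have "(\<lambda>n. f (X n)) \<longlonglongrightarrow> f x"
    by (rule continuous_on_tendsto_compose[OF cont x]) (use nx in_ball[OF P] N_def in auto)
  then have "(\<lambda>n. norm (y - f (X n))) \<longlonglongrightarrow> norm (y - f x)"
    by (intro tendsto_intros)
  moreover have "(\<lambda>n. N * (1/2)^n) \<longlonglongrightarrow> N * 0"
    by (intro tendsto_intros LIMSEQ_realpow_zero) auto
  ultimately have "norm (y - f x) \<le> N * 0"
    by (rule LIMSEQ_le) (use P P_def in auto)
  with nx show ?thesis by (auto simp: N_def)
qed

section \<open>Operators with closed range\<close>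

text \<open>
  The Baire category theorem in the complete space \<open>range f\<close>, covered by the closures of the images
  of the balls of integer radius: one of these closures contains a relative ball, around \<open>c\<close> say,
  and by linearity differences with \<open>c\<close> move that ball to the origin.
\<close>
lemma closed_range_approximate_preimage:
  fixes f :: "'a::banach \<Rightarrow> 'b::banach"
  assumes f: "bounded_linear f" and cl: "closed (range f)"
  shows "\<exists>K\<ge>0. \<forall>y\<in>range f. \<exists>x. norm x \<le> K * norm y \<and> norm (y - f x) \<le> norm y / 2"
proof -
  interpret bounded_linear f by (rule f)
  define F where "F n = closure (f ` cball 0 (real n))" for n
  let ?T = "top_of_set (range f)"
  have F_sub: "F n \<subseteq> range f" for n
    unfolding F_def by (rule closure_minimal[OF _ cl]) auto
  have cover: "range f \<subseteq> \<Union>(range F)"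
  proof
    fix y assume "y \<in> range f"
    then obtain x where "y = f x" by blast
    moreover obtain n where "norm x \<le> real n" using real_arch_simple by blast
    ultimately have "y \<in> F n"
      unfolding F_def by (intro closure_subset[THEN subsetD] image_eqI) auto
    then show "y \<in> \<Union>(range F)" by blast
  qed
  have "\<exists>n. ?T interior_of F n \<noteq> {}"
  proof (rule ccontr)
    assume "\<not> ?thesis"
    moreover have "closedin ?T (F n)" for n
      using F_sub cl by (simp add: closedin_closed_eq F_def)
    moreover have "completely_metrizable_space ?T"
      using cl by (simp add: completely_metrizable_space_closedin completely_metrizable_space_euclidean)
    ultimately have "?T interior_of \<Union>(range F) = {}"
      by (intro Baire_category_alt disjI1) auto
    moreover have "\<Union>(range F) = topspace ?T"
      using cover F_sub by auto
    ultimately show False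
      by (metis interior_of_topspace empty_iff rangeI topspace_euclidean_subtopology)
  qed
  then obtain n c G where G: "openin ?T G" "c \<in> G" "G \<subseteq> F n"
    unfolding interior_of_def by blast
  then obtain r where r: "r > 0" "\<And>z. z \<in> range f \<Longrightarrow> dist z c < r \<Longrightarrow> z \<in> G"
    unfolding openin_euclidean_subtopology_iff by blast
  have c: "c \<in> range f" using G F_sub by blast
  have small: "\<exists>x. norm x \<le> 2 * real n \<and> norm (y - f x) \<le> e"
    if y: "y \<in> range f" "norm y < r" and e: "e > 0" for y e
  proof -
    have "c + y \<in> range f"
      using c y(1) by (auto simp: add[symmetric])
    then have "c + y \<in> F n" using r(2)[of "c + y"] y(2) G(3) by (auto simp: dist_norm)
    moreover have "c \<in> F n" using G by blast
    moreover have "e / 2 > 0" using e by simp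
    ultimately obtain a b where a: "norm a \<le> real n" "dist (f a) (c + y) < e / 2"
      and b: "norm b \<le> real n" "dist (f b) c < e / 2"
      unfolding F_def closure_approachable by (metis (no_types, lifting) imageE mem_cball_0)
    have "y - f (a - b) = (f b - c) - (f a - (c + y))"
      by (simp add: diff)
    then have "norm (y - f (a - b)) \<le> norm (f b - c) + norm (f a - (c + y))"
      by (metis norm_triangle_ineq4)
    then have "norm (y - f (a - b)) \<le> e"
      using a b by (simp add: dist_norm)
    moreover have "norm (a - b) \<le> 2 * real n"
      using norm_triangle_ineq4[of a b] a b by linarith
    ultimately show ?thesis by blast
  qed
  show ?thesis
  proof (intro exI[of _ "4 * real n / r"] conjI ballI)
    show "4 * real n / r \<ge> 0" using r by simp
    fix y assume y: "y \<in> range f"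
    show "\<exists>x. norm x \<le> 4 * real n / r * norm y \<and> norm (y - f x) \<le> norm y / 2"
    proof (cases "y = 0")
      case True
      then show ?thesis by (intro exI[of _ 0]) (simp add: zero)
    next
      case False
      \<comment> \<open>Rescale \<open>y\<close> to norm \<open>r / 2\<close>, where approximation with arbitrarily small error is known.\<close>
      define t where "t = r / (2 * norm y)"
      have t: "t > 0" using r False by (simp add: t_def)
      have "t *\<^sub>R y \<in> range f" using y by (auto simp: scaleR[symmetric])
      moreover have "norm (t *\<^sub>R y) < r" using r False by (simp add: t_def)
      moreover have "t * norm y / 2 > 0" using t False by simp
      ultimately obtain x where x: "norm x \<le> 2 * real n" "norm (t *\<^sub>R y - f x) \<le> t * norm y / 2"
        using small by blast
      have "norm (y - f (x /\<^sub>R t)) = norm (t *\<^sub>R y - f x) / t"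
      proof -
        have "y - f (x /\<^sub>R t) = (t *\<^sub>R y - f x) /\<^sub>R t"
          using t by (simp add: scaleR algebra_simps)
        then show ?thesis using t by (simp add: divide_inverse)
      qed
      also have "\<dots> \<le> norm y / 2"
        using x(2) t by (simp add: field_simps)
      finally have "norm (y - f (x /\<^sub>R t)) \<le> norm y / 2" .
      moreover have "norm (x /\<^sub>R t) \<le> 4 * real n / r * norm y"
      proof -
        have "norm (x /\<^sub>R t) = norm x / t" using t by (simp add: divide_inverse)
        also have "\<dots> \<le> 2 * real n / t" using x(1) t by (simp add: divide_right_mono)
        also have "\<dots> = 4 * real n / r * norm y" by (simp add: t_def)
        finally show ?thesis .
      qed
      ultimately show ?thesis by blast
    qed
  qed
qed

text \<open>
  The open mapping theorem in quantitative form: approximate preimages with relative error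
  \<open>1/2\<close> are corrected successively, the remaining error staying in \<open>range f\<close>.
\<close>
lemma closed_range_bounded_preimage:
  fixes f :: "'a::banach \<Rightarrow> 'b::banach"
  assumes f: "bounded_linear f" and cl: "closed (range f)"
  obtains K where "K > 0" "\<And>y. y \<in> range f \<Longrightarrow> \<exists>x. f x = y \<and> norm x \<le> K * norm y"
proof -
  interpret bounded_linear f by (rule f)
  obtain K where K: "K \<ge> 0"
    and approx: "\<And>y. y \<in> range f \<Longrightarrow> \<exists>x. norm x \<le> K * norm y \<and> norm (y - f x) \<le> norm y / 2"
    using closed_range_approximate_preimage[OF assms] by blast
  have "\<exists>x. f x = y \<and> norm x \<le> (2 * K + 1) * norm y" if y: "y \<in> range f" for y
  proof -
    have "\<exists>x. norm x \<le> 2 * K * norm (y - f 0) \<and> f x = y"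
    proof (rule solvable_if_error_can_be_halved[OF K])
      show "continuous_on (cball 0 (2 * K * norm (y - f 0))) f"
        by (intro continuous_on continuous_on_id)
      fix x
      have "y - f x \<in> range f" using y by (auto simp: diff[symmetric])
      from approx[OF this]
      show "\<exists>h. norm h \<le> K * norm (y - f x) \<and> norm (y - f (x + h)) \<le> norm (y - f x) / 2"
        by (simp add: add diff_diff_add)
    qed
    then obtain x where "norm x \<le> 2 * K * norm y" "f x = y" by (auto simp: zero)
    moreover have "2 * K * norm y \<le> (2 * K + 1) * norm y" by (intro mult_right_mono) auto
    ultimately show ?thesis by fastforce
  qed
  moreover have "2 * K + 1 > 0" using K by simp
  ultimately show ?thesis using that by blast
qed

section \<open>Strict differentiability\<close>

text \<open>
  Continuity of the differential makes it almost constant near \<open>a\<close>, so by the mean value inequality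
  the linearisation error is small uniformly in pairs of points near \<open>a\<close>, and not only relative
  to \<open>a\<close> itself.
\<close>
lemma C1_map_on_strictly_differentiable:
  fixes f :: "'a::real_normed_vector \<Rightarrow> 'b::real_normed_vector"
  assumes f: "C1_map_on f U" and U: "open U" "a \<in> U" and e: "e > 0"
  obtains r where "r > 0" "cball a r \<subseteq> U"
    "\<And>x y. x \<in> cball a r \<Longrightarrow> y \<in> cball a r \<Longrightarrow>
       norm (f y - f x - frechet_derivative f (at a) (y - x)) \<le> e * norm (y - x)"
proof -
  obtain D where D: "\<And>x. x \<in> U \<Longrightarrow> (f has_derivative blinfun_apply (D x)) (at x)"
    and cont: "continuous_on U D"
    using f unfolding C1_map_on_def by blast
  have Da: "frechet_derivative f (at a) = blinfun_apply (D a)"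
    using frechet_derivative_at[OF D[OF U(2)]] by simp
  obtain d where d: "d > 0" "\<And>x. x \<in> U \<Longrightarrow> dist x a < d \<Longrightarrow> dist (D x) (D a) < e"
    using cont U(2) e unfolding continuous_on_iff by blast
  obtain r0 where r0: "r0 > 0" "cball a r0 \<subseteq> U"
    using U open_contains_cball by blast
  define r where "r = min r0 (d / 2)"
  have r: "r > 0" "cball a r \<subseteq> U" using r0 d by (auto simp: r_def)
  have "norm (f y - f x - frechet_derivative f (at a) (y - x)) \<le> e * norm (y - x)"
    if xy: "x \<in> cball a r" "y \<in> cball a r" for x y
  proof -
    have "norm (f y - f x - blinfun_apply (D a) (y - x)) \<le> norm (y - x) * e"
    proof (rule differentiable_bound_linearization[where S = "cball a r" and f' = "\<lambda>x. blinfun_apply (D x)"])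
      fix t :: real assume "t \<in> {0..1}"
      then have "(1 - t) *\<^sub>R x + t *\<^sub>R y \<in> cball a r"
        using convexD[OF convex_cball xy] by auto
      then show "x + t *\<^sub>R (y - x) \<in> cball a r" by (simp add: algebra_simps)
    next
      fix z assume z: "z \<in> cball a r"
      then show "(f has_derivative blinfun_apply (D z)) (at z within cball a r)"
        using D r(2) has_derivative_at_withinI by blast
      have "dist z a < d" using z d(1) by (simp add: r_def dist_commute)
      then have "norm (D z - D a) < e" using d(2)[of z] z r(2) by (auto simp: dist_norm)
      moreover have "blinfun_apply (D z) - blinfun_apply (D a) = blinfun_apply (D z - D a)"
        by (simp add: fun_eq_iff blinfun.diff_left)
      ultimately show "onorm (blinfun_apply (D z) - blinfun_apply (D a)) \<le> e"
        by (simp add: norm_blinfun.rep_eq[symmetric])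
    qed (use r in auto)
    then show ?thesis by (simp add: Da mult.commute)
  qed
  with r that show ?thesis by blast
qed

lemma C1_map_on_imp_has_derivative:
  assumes "C1_map_on f U" "x \<in> U"
  shows "(f has_derivative frechet_derivative f (at x)) (at x)"
  using assms unfolding C1_map_on_def by (metis frechet_derivative_at)

section \<open>Local exactness\<close>

theorem theorem1p2:
  fixes \<phi> :: "'x::banach \<Rightarrow> 'y::banach"
    and \<psi> :: "'y \<Rightarrow> 'z::banach"
    and U :: "'x set" and V :: "'y set"
  assumes "open U" and "0 \<in> U"
    and "open V" and "0 \<in> V"
    and "\<phi> ` U \<subseteq> V"
    and "C1_map_on \<phi> U"
    and "C1_map_on \<psi> V"
    and "\<phi> 0 = 0"
    and "\<And>u. u \<in> U \<Longrightarrow> \<psi> (\<phi> u) = 0"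
    and "range (frechet_derivative \<phi> (at 0)) = {y. frechet_derivative \<psi> (at 0) y = 0}"
    and "closed (range (frechet_derivative \<psi> (at 0)))"
  shows "\<exists>W. W \<subseteq> V \<and> 0 \<in> interior W \<and>
           {v \<in> V. \<psi> v = 0} \<inter> W = \<phi> ` U \<inter> W"
proof -
  define A where "A = frechet_derivative \<phi> (at 0)"
  define B where "B = frechet_derivative \<psi> (at 0)"
  have A: "bounded_linear A" and B: "bounded_linear B"
    using C1_map_on_imp_has_derivative assms has_derivative_bounded_linear
    unfolding A_def B_def by blast+
  interpret B: bounded_linear B by (rule B)
  have exact: "range A = {y. B y = 0}"
    using assms(10) by (simp add: A_def B_def)
  have "closed (range A)"
    unfolding exact by (intro closed_Collect_eq B.continuous_on continuous_on_id continuous_on_const)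
  from closed_range_bounded_preimage[OF A this] obtain C where C: "C > 0"
    and preA: "\<And>y. y \<in> range A \<Longrightarrow> \<exists>x. A x = y \<and> norm x \<le> C * norm y" by blast
  from closed_range_bounded_preimage[OF B] assms(11) obtain D where D: "D > 0"
    and preB: "\<And>z. z \<in> range B \<Longrightarrow> \<exists>y. B y = z \<and> norm y \<le> D * norm z"
    unfolding B_def by blast
  \<comment> \<open>With these tolerances a correction step leaves at most a quarter of the error from moving
    into the kernel of \<open>B\<close> and at most another quarter from linearising \<open>\<phi>\<close>.\<close>
  have "1 / (4 * D) > 0" using D by simp
  from C1_map_on_strictly_differentiable[OF assms(7,3,4) this]
  obtain s where s: "s > 0" "cball 0 s \<subseteq> V"
    and \<psi>: "\<And>x y. x \<in> cball 0 s \<Longrightarrow> y \<in> cball 0 s \<Longrightarrow>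
      norm (\<psi> y - \<psi> x - B (y - x)) \<le> 1 / (4 * D) * norm (y - x)"
    unfolding B_def by metis
  have "1 / (8 * C) > 0" using C by simp
  from C1_map_on_strictly_differentiable[OF assms(6,1,2) this]
  obtain r0 where r0: "r0 > 0" "cball 0 r0 \<subseteq> U"
    and \<phi>0: "\<And>x y. x \<in> cball 0 r0 \<Longrightarrow> y \<in> cball 0 r0 \<Longrightarrow>
      norm (\<phi> y - \<phi> x - A (y - x)) \<le> 1 / (8 * C) * norm (y - x)"
    unfolding A_def by metis
  have cont: "continuous_on U \<phi>"
    using C1_map_on_imp_has_derivative[OF assms(6)] has_derivative_continuous
    by (blast intro: continuous_at_imp_continuous_on)
  then obtain d where d: "d > 0" "\<And>x. x \<in> U \<Longrightarrow> dist x 0 < d \<Longrightarrow> dist (\<phi> x) (\<phi> 0) < s"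
    using assms(2) s(1) unfolding continuous_on_iff by blast
  define r where "r = min r0 (d / 2)"
  have r: "r > 0" "cball 0 r \<subseteq> U"
    and \<phi>: "\<And>x y. x \<in> cball 0 r \<Longrightarrow> y \<in> cball 0 r \<Longrightarrow>
      norm (\<phi> y - \<phi> x - A (y - x)) \<le> 1 / (8 * C) * norm (y - x)"
    using r0 d(1) \<phi>0 by (auto simp: r_def)
  have \<phi>s: "\<phi> x \<in> cball 0 s" if "x \<in> cball 0 r" for x
  proof -
    have "dist x 0 < d" using that d(1) by (simp add: r_def)
    then show ?thesis using d(2)[of x] that r(2) assms(8) by auto
  qed
  \<comment> \<open>For a target \<open>y\<close> the iterates stay within \<open>4 * C * norm y\<close> and a single correction is at most
    \<open>2 * C * norm y\<close>, so no corrected point leaves the ball of radius \<open>r\<close>.\<close>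
  define \<delta> where "\<delta> = min s (r / (6 * C))"
  have \<delta>: "\<delta> > 0" "\<delta> \<le> s" "6 * C * \<delta> \<le> r"
  proof -
    show "\<delta> > 0" "\<delta> \<le> s" using r s C by (auto simp: \<delta>_def)
    have "\<delta> \<le> r / (6 * C)" by (simp add: \<delta>_def)
    then show "6 * C * \<delta> \<le> r" using C by (simp add: field_simps)
  qed
  have solve: "y \<in> \<phi> ` U" if y: "norm y \<le> \<delta>" "\<psi> y = 0" for y
  proof -
    have "6 * C * norm y \<le> 6 * C * \<delta>" using y C by (intro mult_left_mono) auto
    then have yr: "6 * C * norm y \<le> r" using \<delta> by linarith
    have Cy: "0 \<le> C * norm y" using C by simp
    have sub: "cball 0 (2 * (2 * C) * norm (y - \<phi> 0)) \<subseteq> cball (0::'x) r"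
      using yr Cy assms(8) by (auto simp: mult.assoc)
    have "\<exists>x. norm x \<le> 2 * (2 * C) * norm (y - \<phi> 0) \<and> \<phi> x = y"
    proof (rule solvable_if_error_can_be_halved)
      show "continuous_on (cball 0 (2 * (2 * C) * norm (y - \<phi> 0))) \<phi>"
        using continuous_on_subset[OF cont] sub r(2) by blast
    next
      fix x assume x: "norm x \<le> 2 * (2 * C) * norm (y - \<phi> 0)" "norm (y - \<phi> x) \<le> norm (y - \<phi> 0)"
      define e where "e = y - \<phi> x"
      have xr: "x \<in> cball 0 r" using x(1) sub by auto
      then have "x \<in> U" using r(2) by blast
      then have "norm (B e) \<le> 1 / (4 * D) * norm e"
        using \<psi>[OF \<phi>s[OF xr], of y] y \<delta>(2) assms(9) by (simp add: e_def)
      then have "D * norm (B e) \<le> norm e / 4"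
        using D by (simp add: field_simps)
      moreover obtain w where "B w = B e" "norm w \<le> D * norm (B e)"
        using preB[of "B e"] by blast
      ultimately have w: "B w = B e" "norm w \<le> norm e / 4" by auto
      have "e - w \<in> range A" using w by (simp add: exact B.diff)
      then obtain h where h: "A h = e - w" "norm h \<le> C * norm (e - w)"
        using preA by blast
      have "norm (e - w) \<le> 2 * norm e"
        using norm_triangle_ineq4[of e w] w norm_ge_zero[of e] by linarith
      then have "C * norm (e - w) \<le> C * (2 * norm e)"
        using C by (intro mult_left_mono) auto
      with h have hn: "norm h \<le> 2 * C * norm e" by simp
      also have "\<dots> \<le> 2 * C * norm y"
        using x(2) C assms(8) by (intro mult_left_mono) (auto simp: e_def)
      finally have "norm (x + h) \<le> 6 * C * norm y"
        using norm_triangle_ineq[of x h] x(1) assms(8) by simp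
      then have "x + h \<in> cball 0 r" using yr by simp
      from \<phi>[OF xr this] have "norm (\<phi> (x + h) - \<phi> x - A h) \<le> 1 / (8 * C) * norm h" by simp
      also have "\<dots> \<le> 1 / (8 * C) * (2 * C * norm e)"
        using hn C by (intro mult_left_mono) auto
      also have "\<dots> = norm e / 4" using C by simp
      finally have lin: "norm (\<phi> (x + h) - \<phi> x - A h) \<le> norm e / 4" .
      have "y - \<phi> (x + h) = w - (\<phi> (x + h) - \<phi> x - A h)"
        by (simp add: h(1) e_def)
      then have "norm (y - \<phi> (x + h)) \<le> norm w + norm (\<phi> (x + h) - \<phi> x - A h)"
        by (metis norm_triangle_ineq4)
      then have "norm (y - \<phi> (x + h)) \<le> norm e / 2" using lin w(2) by linarith
      with hn show "\<exists>h. norm h \<le> 2 * C * norm (y - \<phi> x) \<and>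
          norm (y - \<phi> (x + h)) \<le> norm (y - \<phi> x) / 2"
        unfolding e_def by blast
    qed (use C in simp)
    then obtain x where "norm x \<le> 2 * (2 * C) * norm (y - \<phi> 0)" "\<phi> x = y" by blast
    moreover from this have "x \<in> U" using sub r(2) by (meson mem_cball_0 subsetD)
    ultimately show ?thesis by blast
  qed
  show ?thesis
  proof (intro exI[of _ "cball 0 \<delta>"] conjI)
    show "cball 0 \<delta> \<subseteq> V" using s(2) \<delta>(2) by (auto simp: subset_iff)
    show "0 \<in> interior (cball 0 \<delta>)"
      using \<delta>(1) by (meson ball_subset_cball centre_in_ball interiorI open_ball)
    show "{v \<in> V. \<psi> v = 0} \<inter> cball 0 \<delta> = \<phi> ` U \<inter> cball 0 \<delta>"
      using solve assms(5,9) by auto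
  qed
qed

end
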